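(* Let $\{x_k\}\subset H$ be a sequence generated by the algorithm described in the context. Suppose that: (i) there are constants $\beta>0$ and $L>0$ such that, for every $k\in\mathbb{N}$ with $f_\star<f(x_k)$, every $x^\star\in X^\star$ and every $z\in\mathrm{cl}\{y\in H: f(y)<f(x_k)\}$, one has $|f(z)-f(x^\star)|\le L\|z-x^\star\|^\beta$; the sequence $\{x_k\}$ is bounded; and $0<\liminf_{k\to\infty}\alpha_k\le\limsup_{k\to\infty}\alpha_k<1$; (ii) the real sequence $\{v_k\}\subset(0,\infty)$ satisfies $\lim_{k\to\infty}v_k=0$ and $\sum_{k=1}^\infty v_k=\infty$. Then there exists a subsequence of $\{x_k\}$ which converges weakly to a point in $X^\star$. In addition, if (iii) $H$ is an $N$-dimensional Euclidean space $\mathbb{R}^N$, and (iv) the solution $x^\star\in X^\star$ is unique (i.e. $X^\star=\{x^\star\}$), then the whole sequence $\{x_k\}$ converges to this unique solution $x^\star$.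
   Context: Setting: $H$ is a real Hilbert space with inner product $\langle\cdot,\cdot\rangle$ and induced norm $\|\cdot\|$. $f:H\to\mathbb{R}$ is continuous and quasiconvex, i.e. $f((1-\alpha)x+\alpha y)\le\max\{f(x),f(y)\}$ for all $x,y\in H$, $\alpha\in[0,1]$. $X,D\subset H$ are nonempty closed convex sets. $T:H\to H$ is firmly nonexpansive, i.e. $\|T(x)-T(y)\|^2+\|(\mathrm{Id}-T)x-(\mathrm{Id}-T)y\|^2\le\|x-y\|^2$ for all $x,y\in H$, and $\mathrm{Fix}(T):=\{x\in H:T(x)=x\}=X$. The set $X\cap D$ is nonempty; put $f_\star:=\inf_{x\in X\cap D}f(x)$ and $X^\star:=\operatorname{argmin}_{x\in X\cap D}f(x)$, and assume $X^\star\neq\emptyset$. $\mathbb{N}$ is the set of positive integers, $\mathrm{cl}$ denotes closure, and $P_D$ is the metric projection onto $D$. Subdifferential: $\partial^\star f(x):=\{g\in H:\langle g,y-x\rangle\le 0\text{ for all }y\in H\text{ with }f(y)<f(x)\}$. Algorithm: given $\{v_k\}\subset(0,\infty)$ and $\{\alpha_k\}\subset(0,1]$, choose $x_1\in D$ and, for $k=1,2,\ldots$, choose any $g_k\in\partial^\star f(x_k)$ with $\|g_k\|=1$ and set $x_{k+1}:=P_D(\alpha_kx_k+(1-\alpha_k)T(x_k-v_kg_k))$. *)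

theory Defs
  imports "HOL-Analysis.Analysis"
begin

text \<open>
  A real Hilbert space is a type of sort \<open>{real_inner, complete_space}\<close>. Sequences of the
  algorithm are indexed by the positive integers; they are functions on \<open>nat\<close> whose value
  at \<open>0\<close> is never constrained.
\<close>

definition quasiconvex :: "('a::real_vector \<Rightarrow> real) \<Rightarrow> bool" where
  "quasiconvex f \<longleftrightarrow>
    (\<forall>x y. \<forall>\<alpha>\<in>{0..1}. f ((1 - \<alpha>) *\<^sub>R x + \<alpha> *\<^sub>R y) \<le> max (f x) (f y))"

definition firmly_nonexpansive :: "('a::real_normed_vector \<Rightarrow> 'a) \<Rightarrow> bool" where
  "firmly_nonexpansive T \<longleftrightarrow>
    (\<forall>x y. (norm (T x - T y))\<^sup>2 + (norm ((x - T x) - (y - T y)))\<^sup>2 \<le> (norm (x - y))\<^sup>2)"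

definition Fix :: "('a \<Rightarrow> 'a) \<Rightarrow> 'a set" where
  "Fix T = {x. T x = x}"

definition argmin_set :: "('a \<Rightarrow> real) \<Rightarrow> 'a set \<Rightarrow> 'a set" where
  "argmin_set f S = {x. is_arg_min f (\<lambda>y. y \<in> S) x}"

text \<open>
  The library's \<open>closest_point\<close> requires a Heine-Borel space and hence excludes
  infinite-dimensional Hilbert spaces. As there, the value is a chosen nearest point; on a
  nonempty closed convex subset of a Hilbert space the nearest point exists and is unique.
\<close>

definition metric_projection :: "'a::metric_space set \<Rightarrow> 'a \<Rightarrow> 'a" where
  "metric_projection D x = arg_min_on (dist x) D"

definition star_subdifferential :: "('a::real_inner \<Rightarrow> real) \<Rightarrow> 'a \<Rightarrow> 'a set" where
  "star_subdifferential f x = {g. \<forall>y. f y < f x \<longrightarrow> g \<bullet> (y - x) \<le> 0}"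

definition weakly_converges :: "(nat \<Rightarrow> 'a::real_inner) \<Rightarrow> 'a \<Rightarrow> bool" where
  "weakly_converges s p \<longleftrightarrow> (\<forall>h. (\<lambda>n. s n \<bullet> h) \<longlonglongrightarrow> p \<bullet> h)"

end

theory Submission
  imports Defs "HOL-Library.Diagonal_Subsequence"
begin

text \<open>
  Fix a minimiser \<open>xs\<close>, write \<open>u k = x k - v k *\<^sub>R g k\<close>, and let \<open>\<Gamma> k\<close> be the square of the distance
  from \<open>x k\<close> to \<open>xs\<close>. Everything rests on one inequality (\<open>step_norm_square_le\<close>): as \<open>T\<close> is firmly
  nonexpansive and the projection onto \<open>D\<close> brings points closer to \<open>xs\<close>, a step lowers \<open>\<Gamma>\<close> by
  at least \<open>(1 - \<alpha> k) * (2 * v k * (g k \<bullet> (x k - xs)) - (v k)\<^sup>2 + (norm (u k - T (u k)))\<^sup>2)\<close>.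

  Call the index \<open>k\<close> near-optimal with tolerance \<open>e\<close> if both the residual \<open>norm (u k - T (u k))\<close>
  and the excess \<open>f (x k) - f xs\<close> are below \<open>e\<close>. If the excess is at least \<open>e\<close>, then the Hoelder condition puts a
  whole ball around \<open>xs\<close>, of a radius \<open>r\<close> depending only on \<open>e\<close>, into the strict sublevel set of
  \<open>x k\<close>; the subgradient \<open>g k\<close> separates that ball from \<open>x k\<close>, whence \<open>g k \<bullet> (x k - xs) \<ge> r\<close>. If the
  residual is at least \<open>e\<close>, its square dominates all the terms of order \<open>v k\<close>. Either way an
  index that is not near-optimal and is large enough lowers \<open>\<Gamma>\<close> by at least \<open>c * v k\<close>
  (\<open>decrease_if_not_near_optimal\<close>). The steps \<open>v k\<close> have a divergent sum, so this cannot go on for ever, and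
  near-optimal indices of every tolerance occur infinitely often.

  Choose a subsequence whose tolerances tend to \<open>0\<close>. By weak sequential compactness it may be
  taken weakly convergent. Its limit is a fixed point of \<open>T\<close> by demiclosedness, lies in \<open>D\<close>
  because closed convex sets are weakly closed, and has value at most \<open>f xs\<close> because the
  sublevel sets of \<open>f\<close> are closed and convex as well. So it is a minimiser.

  Now let the dimension be finite and \<open>xs\<close> the only minimiser. If near-optimal indices of every
  tolerance occurred infinitely often outside a fixed ball around \<open>xs\<close>, the same argument would produce a
  minimiser different from \<open>xs\<close>. Hence outside every such ball \<open>\<Gamma>\<close> eventually decreases by a
  multiple of \<open>v k\<close>, while from inside a single step increases it by a quantity that tends to \<open>0\<close>. The
  sequence therefore enters every ball and, from some index on, stays in a slightly larger one
  (\<open>tendsto_zero_if_decreasing_away_from_zero\<close>).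
\<close>

section \<open>Closed convex sets in a Hilbert space\<close>

lemma infdist_less_imp_dist_less:
  assumes "infdist z C < r" "C \<noteq> {}"
  obtains y where "y \<in> C" "dist z y < r"
  using assms that by (auto simp: infdist_notempty cINF_less_iff simp del: dist_0_norm)

text \<open>
  A substitute for compactness. The distances from the origin to the sets increase to a limit
  \<open>l\<close>; by the parallelogram law the points of \<open>C n\<close> of norm close to \<open>l\<close> form sets whose diameters
  tend to \<open>0\<close>, so completeness applies. Nearest points and weak limits are both obtained from this lemma.
\<close>

lemma nested_closed_convex_Inter_nonempty:
  fixes C :: "nat \<Rightarrow> 'a::{real_inner, complete_space} set"
  assumes closed: "\<And>n. closed (C n)" and convex: "\<And>n. convex (C n)"
    and ne: "\<And>n. C n \<noteq> {}" and dec: "\<And>m n. m \<le> n \<Longrightarrow> C n \<subseteq> C m"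
    and bdd: "bounded (C 0)"
  obtains p where "\<And>n. p \<in> C n"
proof -
  define d where "d n = infdist 0 (C n)" for n
  obtain B where B: "\<And>y. y \<in> C 0 \<Longrightarrow> norm y \<le> B"
    using bdd by (auto simp: bounded_iff)
  have "d n \<le> B" for n
  proof -
    obtain y where y: "y \<in> C n" using ne by blast
    have "d n \<le> norm y" using infdist_le[OF y, of 0] by (simp add: d_def)
    also have "\<dots> \<le> B" using B y dec[of 0 n] by auto
    finally show ?thesis .
  qed
  moreover have "incseq d"
    unfolding incseq_def d_def using ne dec by (auto intro!: infdist_mono)
  ultimately obtain l where l: "d \<longlonglongrightarrow> l" and le: "\<And>n. d n \<le> l"
    using incseq_convergent by metis
  define S where "S n = C n \<inter> cball 0 (l + 1 / real (Suc n))" for n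
  obtain p where p: "\<And>n. p \<in> S n"
  proof (rule decreasing_closed_nest)
    show "closed (S n)" for n unfolding S_def using closed by blast
    show "S n \<noteq> {}" for n
    proof -
      have "infdist 0 (C n) < l + 1 / real (Suc n)"
        using le[of n] by (simp add: d_def add_pos_nonneg add_strict_increasing2 less_add_same_cancel1 order.strict_trans1)
      then obtain y where "y \<in> C n" "dist 0 y < l + 1 / real (Suc n)"
        using ne[of n] infdist_less_imp_dist_less by blast
      then show ?thesis by (force simp: S_def)
    qed
    show "S n \<subseteq> S m" if "m \<le> n" for m n
    proof -
      have "1 / real (Suc n) \<le> 1 / real (Suc m)" using that by (simp add: frac_le)
      then show ?thesis unfolding S_def using dec[OF that] by (auto intro: order_trans)
    qed
    fix e :: real assume "e > 0"
    \<comment> \<open>The midpoint of two points of \<open>S n\<close> lies in \<open>C n\<close>, so its norm is at least \<open>d n\<close>.\<close>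
    have diam: "(dist y z)\<^sup>2 \<le> 4 * (l + 1 / real (Suc n))\<^sup>2 - 4 * (d n)\<^sup>2"
      if "y \<in> S n" "z \<in> S n" for n y z
    proof -
      have "(1/2) *\<^sub>R y + (1/2) *\<^sub>R z \<in> C n"
        using convexD[OF convex[of n], of y z "1/2" "1/2"] that by (simp add: S_def)
      from infdist_le[OF this, of 0] have "2 * d n \<le> norm (y + z)"
        by (simp add: d_def flip: scaleR_add_right)
      then have "(2 * d n)\<^sup>2 \<le> (norm (y + z))\<^sup>2"
        by (intro power_mono) (auto simp: d_def infdist_nonneg)
      moreover have "(norm y)\<^sup>2 \<le> (l + 1 / real (Suc n))\<^sup>2" "(norm z)\<^sup>2 \<le> (l + 1 / real (Suc n))\<^sup>2"
        using that by (auto simp: S_def intro!: power_mono)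
      moreover have "(norm (y - z))\<^sup>2 + (norm (y + z))\<^sup>2 = 2 * (norm y)\<^sup>2 + 2 * (norm z)\<^sup>2"
        by (simp add: power2_norm_eq_inner algebra_simps inner_commute)
      ultimately show ?thesis by (simp add: dist_norm)
    qed
    have "(\<lambda>n. 4 * (l + 1 / real (Suc n))\<^sup>2 - 4 * (d n)\<^sup>2) \<longlonglongrightarrow> 4 * (l + 0)\<^sup>2 - 4 * l\<^sup>2"
      by (intro tendsto_intros l LIMSEQ_Suc[OF lim_1_over_n])
    then have "\<forall>\<^sub>F n in sequentially. 4 * (l + 1 / real (Suc n))\<^sup>2 - 4 * (d n)\<^sup>2 < e\<^sup>2"
      using \<open>e > 0\<close> by (intro order_tendstoD) auto
    then obtain n where n: "4 * (l + 1 / real (Suc n))\<^sup>2 - 4 * (d n)\<^sup>2 < e\<^sup>2"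
      by (auto simp: eventually_sequentially)
    have "dist y z < e" if "y \<in> S n" "z \<in> S n" for y z
      using diam[OF that] n \<open>e > 0\<close> power2_less_imp_less[of "dist y z" e] by simp
    then show "\<exists>n. \<forall>x\<in>S n. \<forall>y\<in>S n. dist x y < e" by blast
  qed blast
  then show ?thesis using that by (auto simp: S_def)
qed

lemma nearest_point_exists:
  fixes D :: "'a::{real_inner, complete_space} set"
  assumes "closed D" "convex D" "D \<noteq> {}"
  obtains q where "q \<in> D" "\<And>y. y \<in> D \<Longrightarrow> dist z q \<le> dist z y"
proof -
  define r where "r n = infdist z D + 1 / real (Suc n)" for n
  have r_antimono: "r n \<le> r m" if "m \<le> n" for m n
    using that by (simp add: r_def frac_le)
  have ne: "D \<inter> cball z (r n) \<noteq> {}" for n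
  proof -
    have "infdist z D < r n" by (simp add: r_def)
    then obtain y where "y \<in> D" "dist z y < r n"
      using assms(3) infdist_less_imp_dist_less by blast
    then show ?thesis by force
  qed
  obtain q where q: "\<And>n. q \<in> D \<inter> cball z (r n)"
  proof (rule nested_closed_convex_Inter_nonempty)
    show "D \<inter> cball z (r n) \<subseteq> D \<inter> cball z (r m)" if "m \<le> n" for m n
      using r_antimono[OF that] by auto
  qed (use assms ne in \<open>auto intro: convex_Int\<close>)
  have "r \<longlonglongrightarrow> infdist z D + 0"
    unfolding r_def by (intro tendsto_intros LIMSEQ_Suc[OF lim_1_over_n])
  then have "dist z q \<le> infdist z D"
    using q by (intro LIMSEQ_le_const) auto
  then show ?thesis using that[of q] q infdist_le order_trans by blast
qed

lemma metric_projection: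
  fixes D :: "'a::{real_inner, complete_space} set"
  assumes "closed D" "convex D" "D \<noteq> {}"
  shows metric_projection_mem: "metric_projection D z \<in> D"
    and metric_projection_obtuse:
      "y \<in> D \<Longrightarrow> (z - metric_projection D z) \<bullet> (y - metric_projection D z) \<le> 0"
proof -
  obtain q where "q \<in> D" "\<And>y. y \<in> D \<Longrightarrow> dist z q \<le> dist z y"
    using nearest_point_exists[OF assms] by metis
  then have "is_arg_min (dist z) (\<lambda>y. y \<in> D) q"
    by (auto simp: is_arg_min_linorder)
  then have "is_arg_min (dist z) (\<lambda>y. y \<in> D) (metric_projection D z)"
    unfolding metric_projection_def arg_min_on_def arg_min_def by (rule someI)
  then show mem: "metric_projection D z \<in> D"
    and "y \<in> D \<Longrightarrow> (z - metric_projection D z) \<bullet> (y - metric_projection D z) \<le> 0"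
    using any_closest_point_dot[OF assms(2,1)] by (auto simp: is_arg_min_linorder)
qed

lemma metric_projection_Fejer:
  fixes D :: "'a::{real_inner, complete_space} set"
  assumes "closed D" "convex D" "y \<in> D"
  shows "norm (metric_projection D z - y) \<le> norm (z - y)"
proof -
  define q where "q = metric_projection D z"
  have "(z - q) \<bullet> (y - q) \<le> 0"
    unfolding q_def using assms by (intro metric_projection_obtuse) auto
  then have "(norm (q - y))\<^sup>2 + (norm (z - q))\<^sup>2 \<le> (norm (z - y))\<^sup>2"
    by (simp add: power2_norm_eq_inner algebra_simps inner_commute)
  then have "(norm (q - y))\<^sup>2 \<le> (norm (z - y))\<^sup>2"
    by (smt (verit) zero_le_power2)
  then show ?thesis unfolding q_def by (rule power2_le_imp_le) simp
qed

text \<open>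
  Let \<open>q\<close> be the projection of the weak limit \<open>p\<close>. The set \<open>C\<close> lies in the half-space of all \<open>y\<close> with
  \<open>(p - q) \<bullet> (y - q) \<le> 0\<close>, and this inequality passes to the weak limit, which forces \<open>p = q\<close>.
\<close>

lemma weakly_convergent_limit_mem:
  fixes C :: "'a::{real_inner, complete_space} set"
  assumes "closed C" "convex C" "weakly_converges s p" "\<forall>\<^sub>F n in sequentially. s n \<in> C"
  shows "p \<in> C"
proof -
  define q where "q = metric_projection C p"
  have "C \<noteq> {}" using assms(4) eventually_happens' trivial_limit_sequentially by blast
  then have q: "q \<in> C" and obtuse: "\<And>y. y \<in> C \<Longrightarrow> (p - q) \<bullet> (y - q) \<le> 0"
    using metric_projection[OF assms(1,2)] by (auto simp: q_def)
  have "(\<lambda>n. s n \<bullet> (p - q)) \<longlonglongrightarrow> p \<bullet> (p - q)"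
    using assms(3) by (simp add: weakly_converges_def)
  moreover have "\<forall>\<^sub>F n in sequentially. s n \<bullet> (p - q) \<le> q \<bullet> (p - q)"
    using assms(4)
    by (rule eventually_mono) (use obtuse in \<open>force simp: inner_diff_right inner_commute\<close>)
  ultimately have "p \<bullet> (p - q) \<le> q \<bullet> (p - q)"
    by (rule tendsto_upperbound) simp
  then have "(p - q) \<bullet> (p - q) \<le> 0" by (simp add: inner_diff_left)
  then show ?thesis using q by (metis inner_gt_zero_iff leD right_minus_eq)
qed

section \<open>Weak convergence\<close>

lemma strict_mono_choice:
  fixes Q :: "nat \<Rightarrow> nat \<Rightarrow> bool"
  assumes "\<And>n m. \<exists>k\<ge>m. Q n k"
  shows "\<exists>r. strict_mono r \<and> (\<forall>n. Q n (r n))"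
proof -
  have "\<exists>r. \<forall>n. Q n (r n) \<and> r n < r (Suc n)"
    by (rule dependent_nat_choice) (use assms Suc_le_eq in blast)+
  then show ?thesis by (auto simp: strict_mono_Suc_iff)
qed

text \<open>
  The closed convex hulls of the tails are nested, so they have a common point. Such a point is
  the only candidate for a weak limit, by \<open>asymptotic_hull_point_inner\<close>; this yields the limit without
  representing a bounded functional by a vector.
\<close>

lemma bounded_imp_asymptotic_hull_point:
  fixes s :: "nat \<Rightarrow> 'a::{real_inner, complete_space}"
  assumes bdd: "bounded (range s)"
  obtains p where
    "\<And>C. closed C \<Longrightarrow> convex C \<Longrightarrow> \<forall>\<^sub>F n in sequentially. s n \<in> C \<Longrightarrow> p \<in> C"
proof -
  define K where "K n = closure (convex hull (s ` {n..}))" for n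
  obtain p where p: "\<And>n. p \<in> K n"
  proof (rule nested_closed_convex_Inter_nonempty)
    show "K n \<subseteq> K m" if "m \<le> n" for m n
      unfolding K_def using that by (intro closure_mono hull_mono image_mono) auto
    have "bounded (s ` {0..})" using bdd by simp
    then show "bounded (K 0)"
      unfolding K_def by (intro bounded_closure bounded_convex_hull)
  qed (auto simp: K_def convex_closure)
  show ?thesis
  proof (rule that)
    fix C :: "'a set"
    assume C: "closed C" "convex C" "\<forall>\<^sub>F n in sequentially. s n \<in> C"
    then obtain n where "s ` {n..} \<subseteq> C" by (auto simp: eventually_sequentially)
    then have "K n \<subseteq> C"
      unfolding K_def using C by (intro closure_minimal hull_minimal)
    then show "p \<in> C" using p by blast
  qed
qed

text \<open>
  The slabs of all \<open>y\<close> with \<open>y \<bullet> h\<close> within \<open>e\<close> of \<open>c\<close> are closed, convex and contain a tail.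
\<close>

lemma asymptotic_hull_point_inner:
  fixes s :: "nat \<Rightarrow> 'a::real_inner"
  assumes p: "\<And>C. closed C \<Longrightarrow> convex C \<Longrightarrow> \<forall>\<^sub>F n in sequentially. s n \<in> C \<Longrightarrow> p \<in> C"
    and lim: "(\<lambda>n. s n \<bullet> h) \<longlonglongrightarrow> c"
  shows "p \<bullet> h = c"
proof (rule antisym)
  show "p \<bullet> h \<le> c"
  proof (rule field_le_epsilon)
    fix e :: real assume "e > 0"
    then have "\<forall>\<^sub>F n in sequentially. s n \<bullet> h < c + e"
      by (intro order_tendstoD[OF lim]) simp
    then have "p \<in> {y. h \<bullet> y \<le> c + e}"
      by (intro p closed_halfspace_le convex_halfspace_le)
        (auto elim: eventually_mono simp: inner_commute)
    then show "p \<bullet> h \<le> c + e" by (simp add: inner_commute)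
  qed
  show "c \<le> p \<bullet> h"
  proof (rule field_le_epsilon)
    fix e :: real assume "e > 0"
    then have "\<forall>\<^sub>F n in sequentially. s n \<bullet> h > c - e"
      by (intro order_tendstoD[OF lim]) simp
    then have "p \<in> {y. h \<bullet> y \<ge> c - e}"
      by (intro p closed_halfspace_ge convex_halfspace_ge)
        (auto elim: eventually_mono simp: inner_commute)
    then show "c \<le> p \<bullet> h + e" by (simp add: inner_commute)
  qed
qed

lemma bounded_imp_inner_convergent_subseq:
  fixes s :: "nat \<Rightarrow> 'a::real_inner" and t :: "nat \<Rightarrow> 'a"
  assumes "bounded (range s)"
  obtains r where "strict_mono (r :: nat \<Rightarrow> nat)" "\<And>m. convergent (\<lambda>n. s (r n) \<bullet> t m)"
proof -
  have sub: "\<exists>r. strict_mono r \<and> convergent (\<lambda>n. s (q (r n)) \<bullet> h)" for q :: "nat \<Rightarrow> nat" and h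
  proof -
    have "bounded ((\<lambda>y. y \<bullet> h) ` range s)"
      by (intro bounded_linear_image assms bounded_linear_inner_left)
    then have "bounded (range (\<lambda>n. s (q n) \<bullet> h))"
      by (rule bounded_subset) auto
    from bounded_imp_convergent_subsequence[OF this] show ?thesis
      by (auto simp: convergent_def o_def)
  qed
  interpret subseqs "\<lambda>m r. convergent (\<lambda>n. s (r n) \<bullet> t m)"
    by unfold_locales (use sub in \<open>auto simp: o_def\<close>)
  have "convergent (\<lambda>n. s (diagseq n) \<bullet> t m)" for m
  proof -
    have "convergent (\<lambda>n. s ((diagseq \<circ> (+) (Suc m)) n) \<bullet> t m)"
      by (rule diagseq_holds) (auto dest: convergent_subseq_convergent simp: o_def)
    then show ?thesis
      using convergent_ignore_initial_segment[of "\<lambda>n. s (diagseq n) \<bullet> t m" "Suc m"]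
      by (simp add: add.commute)
  qed
  then show ?thesis using that subseq_diagseq by blast
qed

text \<open>
  Weak sequential compactness of balls. A diagonal subsequence has convergent inner products
  with every member of the sequence itself; it converges weakly to its asymptotic hull point
  \<open>p\<close>. For if the inner products with some \<open>h\<close> stayed away from \<open>p \<bullet> h\<close> along a further subsequence, then
  that subsequence would have an asymptotic hull point \<open>q\<close> with \<open>q \<bullet> h \<noteq> p \<bullet> h\<close>; but \<open>q - p\<close> is orthogonal to all
  members of the sequence and lies in their closed span, so it vanishes.
\<close>

lemma bounded_imp_weakly_convergent_subseq:
  fixes s :: "nat \<Rightarrow> 'a::{real_inner, complete_space}"
  assumes bdd: "bounded (range s)"
  obtains r p where "strict_mono (r :: nat \<Rightarrow> nat)" "weakly_converges (s \<circ> r) p"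
proof -
  obtain r where r: "strict_mono r" and conv: "\<And>m. convergent (\<lambda>n. s (r n) \<bullet> s m)"
    using bounded_imp_inner_convergent_subseq[OF bdd, of s] by blast
  have bdd_sub: "bounded (range (s \<circ> q))" for q :: "nat \<Rightarrow> nat"
    by (rule bounded_subset[OF bdd]) auto
  obtain p where p: "\<And>C. closed C \<Longrightarrow> convex C \<Longrightarrow>
      \<forall>\<^sub>F n in sequentially. (s \<circ> r) n \<in> C \<Longrightarrow> p \<in> C"
    using bounded_imp_asymptotic_hull_point[OF bdd_sub] by metis
  have "(\<lambda>n. s (r n) \<bullet> h) \<longlonglongrightarrow> p \<bullet> h" for h
  proof (rule ccontr)
    assume "\<not> ?thesis"
    then obtain e where "e > 0" and e: "\<And>m. \<exists>n\<ge>m. \<bar>s (r n) \<bullet> h - p \<bullet> h\<bar> \<ge> e"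
      by (force simp: lim_sequentially dist_real_def not_less)
    from strict_mono_choice[of "\<lambda>_ n. \<bar>s (r n) \<bullet> h - p \<bullet> h\<bar> \<ge> e", OF e]
    obtain a :: "nat \<Rightarrow> nat" where a: "strict_mono a" "\<And>n. \<bar>s (r (a n)) \<bullet> h - p \<bullet> h\<bar> \<ge> e" by blast
    obtain b :: "nat \<Rightarrow> nat" where b: "strict_mono b"
      and "convergent (\<lambda>n. (s \<circ> (r \<circ> a)) (b n) \<bullet> h)"
      using bounded_imp_inner_convergent_subseq[OF bdd_sub, of "r \<circ> a" "\<lambda>_. h"] by blast
    then obtain c where c: "(\<lambda>n. s (r (a (b n))) \<bullet> h) \<longlonglongrightarrow> c"
      by (auto simp: convergent_def)
    obtain q where q: "\<And>C. closed C \<Longrightarrow> convex C \<Longrightarrow>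
        \<forall>\<^sub>F n in sequentially. (s \<circ> (r \<circ> a \<circ> b)) n \<in> C \<Longrightarrow> q \<in> C"
      using bounded_imp_asymptotic_hull_point[OF bdd_sub] by metis
    have "q \<bullet> h = c"
      by (rule asymptotic_hull_point_inner[OF q]) (use c in \<open>auto simp: o_def\<close>)
    \<comment> \<open>Both \<open>p\<close> and \<open>q\<close> lie in the closed span of the sequence, and no \<open>s m\<close> separates them.\<close>
    have same: "q \<bullet> s m = p \<bullet> s m" for m
    proof -
      obtain l where l: "(\<lambda>n. s (r n) \<bullet> s m) \<longlonglongrightarrow> l"
        using conv by (auto simp: convergent_def)
      have "p \<bullet> s m = l"
        by (rule asymptotic_hull_point_inner[OF p]) (use l in \<open>auto simp: o_def\<close>)
      moreover have "q \<bullet> s m = l"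
        by (rule asymptotic_hull_point_inner[OF q])
          (use LIMSEQ_subseq_LIMSEQ[OF l strict_mono_o[OF a(1) b]] in \<open>auto simp: o_def\<close>)
      ultimately show ?thesis by simp
    qed
    have "q \<in> {y. (q - p) \<bullet> y = 0}"
      by (intro q closed_hyperplane convex_hyperplane) (simp add: inner_diff_left same)
    moreover have "p \<in> {y. (q - p) \<bullet> y = 0}"
      by (intro p closed_hyperplane convex_hyperplane) (simp add: inner_diff_left same)
    ultimately have "(q - p) \<bullet> (q - p) = 0" by (simp add: inner_diff_right)
    then have "c = p \<bullet> h" using \<open>q \<bullet> h = c\<close> by simp
    moreover have "(\<lambda>n. \<bar>s (r (a (b n))) \<bullet> h - p \<bullet> h\<bar>) \<longlonglongrightarrow> \<bar>c - p \<bullet> h\<bar>"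
      by (intro tendsto_intros c)
    then have "e \<le> \<bar>c - p \<bullet> h\<bar>" by (rule LIMSEQ_le_const) (use a in auto)
    ultimately show False using \<open>e > 0\<close> by simp
  qed
  then show ?thesis using that r by (auto simp: weakly_converges_def o_def)
qed

text \<open>
  Coordinates with respect to an orthogonal spanning set are inner products up to scaling. The set \<open>C\<close> in the proof may
  contain \<open>0\<close>, whose coordinate \<open>(y \<bullet> 0) / (0 \<bullet> 0)\<close> is \<open>0\<close> and whose term vanishes anyway.
\<close>

lemma weakly_convergent_finite_dim:
  fixes s :: "nat \<Rightarrow> 'a::real_inner" and B :: "'a set"
  assumes "finite B" "span B = UNIV" "weakly_converges s p"
  shows "s \<longlonglongrightarrow> p"
proof -
  obtain C :: "'a set" where C: "finite C" "span C = span B" "pairwise orthogonal C"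
    using basis_orthogonal[OF assms(1)] by blast
  have expand: "y = (\<Sum>b\<in>C. ((y \<bullet> b) / (b \<bullet> b)) *\<^sub>R b)" for y
  proof -
    obtain u where u: "y = (\<Sum>b\<in>C. u b *\<^sub>R b)"
      using C(1,2) assms(2) by (auto simp: span_finite)
    have "y \<bullet> b = u b * (b \<bullet> b)" if "b \<in> C" for b
    proof -
      have "y \<bullet> b = (\<Sum>c\<in>C. u c * (c \<bullet> b))" by (simp add: u inner_sum_left)
      also have "\<dots> = (\<Sum>c\<in>C. if c = b then u b * (b \<bullet> b) else 0)"
        using C(3) that by (intro sum.cong) (auto simp: pairwise_def orthogonal_def)
      finally show ?thesis using C(1) that by simp
    qed
    then show ?thesis by (subst u) (auto intro!: sum.cong)
  qed
  have "(\<lambda>n. \<Sum>b\<in>C. ((s n \<bullet> b) / (b \<bullet> b)) *\<^sub>R b) \<longlonglongrightarrow> (\<Sum>b\<in>C. ((p \<bullet> b) / (b \<bullet> b)) *\<^sub>R b)"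
    using assms(3) unfolding weakly_converges_def divide_inverse
    by (intro tendsto_sum tendsto_scaleR tendsto_mult tendsto_const) auto
  then show ?thesis using expand by simp
qed

lemma weakly_converges_add_null:
  fixes s t :: "nat \<Rightarrow> 'a::real_inner"
  assumes "weakly_converges s p" "t \<longlonglongrightarrow> 0"
  shows "weakly_converges (\<lambda>n. s n + t n) p"
  unfolding weakly_converges_def
proof
  fix h
  have "(\<lambda>n. s n \<bullet> h + t n \<bullet> h) \<longlonglongrightarrow> p \<bullet> h + 0 \<bullet> h"
    using assms(1) unfolding weakly_converges_def
    by (intro tendsto_add tendsto_inner[OF assms(2) tendsto_const]) auto
  then show "(\<lambda>n. (s n + t n) \<bullet> h) \<longlonglongrightarrow> p \<bullet> h" by (simp add: inner_add_left)
qed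

text \<open>
  Demiclosedness. Firm nonexpansiveness makes \<open>u - T u\<close> cocoercive: with \<open>e n = u n - T (u n)\<close>
  and \<open>w = p - T p\<close> it gives \<open>(norm (e n - w))\<^sup>2 \<le> (u n - p) \<bullet> (e n - w)\<close>. The left-hand side tends to
  \<open>(norm w)\<^sup>2\<close>. The right-hand side tends to \<open>0\<close>, as \<open>u n - p\<close> is bounded and weakly null and \<open>e n\<close> tends to \<open>0\<close>.
\<close>

lemma firmly_nonexpansive_demiclosed:
  fixes T :: "'a::real_inner \<Rightarrow> 'a"
  assumes T: "firmly_nonexpansive T" and weak: "weakly_converges u p"
    and bdd: "bounded (range u)" and res: "(\<lambda>n. u n - T (u n)) \<longlonglongrightarrow> 0"
  shows "T p = p"
proof -
  define e where "e n = u n - T (u n)" for n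
  define w where "w = p - T p"
  have firm: "(norm (e n - w))\<^sup>2 \<le> (u n - p) \<bullet> e n - (u n \<bullet> w - p \<bullet> w)" for n
  proof -
    have "(norm (T (u n) - T p))\<^sup>2 + (norm (e n - w))\<^sup>2 \<le> (norm (u n - p))\<^sup>2"
      using T by (simp add: firmly_nonexpansive_def e_def w_def)
    moreover have "T (u n) - T p = (u n - p) - (e n - w)" by (simp add: e_def w_def)
    ultimately have "(norm (e n - w))\<^sup>2 \<le> (u n - p) \<bullet> (e n - w)"
      by (simp add: power2_norm_eq_inner inner_diff_left inner_diff_right inner_commute)
    then show ?thesis by (simp add: inner_diff_left inner_diff_right)
  qed
  obtain B where B: "\<And>n. norm (u n) \<le> B" using bdd by (auto simp: bounded_iff)
  have e0: "e \<longlonglongrightarrow> 0" using res by (simp add: e_def[abs_def])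
  have "(\<lambda>n. (u n - p) \<bullet> e n) \<longlonglongrightarrow> 0"
  proof (rule Lim_null_comparison)
    show "\<forall>\<^sub>F n in sequentially. norm ((u n - p) \<bullet> e n) \<le> (B + norm p) * norm (e n)"
    proof (intro always_eventually allI)
      fix n
      have "norm (u n - p) \<le> B + norm p" using B[of n] norm_triangle_ineq4[of "u n" p] by simp
      then show "norm ((u n - p) \<bullet> e n) \<le> (B + norm p) * norm (e n)"
        using Cauchy_Schwarz_ineq2[of "u n - p" "e n"]
          mult_right_mono[of "norm (u n - p)" "B + norm p" "norm (e n)"] by simp
    qed
    show "(\<lambda>n. (B + norm p) * norm (e n)) \<longlonglongrightarrow> 0"
      using tendsto_mult_right_zero[OF tendsto_norm_zero[OF e0]] .
  qed
  then have "(\<lambda>n. (u n - p) \<bullet> e n - (u n \<bullet> w - p \<bullet> w)) \<longlonglongrightarrow> 0 - (p \<bullet> w - p \<bullet> w)"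
    using weak unfolding weakly_converges_def by (intro tendsto_diff tendsto_const) auto
  moreover have "(\<lambda>n. (norm (e n - w))\<^sup>2) \<longlonglongrightarrow> (norm (0 - w))\<^sup>2"
    by (intro tendsto_intros e0)
  ultimately have "(norm (0 - w))\<^sup>2 \<le> 0 - (p \<bullet> w - p \<bullet> w)"
    using firm by (intro LIMSEQ_le) auto
  then show ?thesis by (simp add: w_def)
qed

section \<open>The one-step estimate\<close>

text \<open>
  The point at distance \<open>r\<close> from \<open>y\<close> in the direction \<open>g\<close> still lies in the strict sublevel set of
  \<open>x\<close>: otherwise the segment leading to it would meet the frontier of that set in a point \<open>z\<close> with
  \<open>f z \<ge> f x\<close>, against the Hoelder condition at \<open>z\<close>. Testing the subgradient at this point gains the term
  \<open>r * (norm g)\<^sup>2 = r\<close>.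
\<close>

lemma subgradient_inner_lower_bound:
  fixes f :: "'a::real_inner \<Rightarrow> real"
  assumes f_cont: "continuous_on UNIV f"
    and g: "g \<in> star_subdifferential f x" "norm g = 1"
    and less: "f y < f x"
    and hoelder: "\<And>z. z \<in> closure {w. f w < f x} \<Longrightarrow> \<bar>f z - f y\<bar> \<le> L * norm (z - y) powr \<beta>"
    and nonneg: "0 \<le> L" "0 \<le> \<beta>" "0 \<le> r"
    and r: "L * r powr \<beta> < f x - f y"
  shows "r \<le> g \<bullet> (x - y)"
proof -
  define S where "S = {w. f w < f x}"
  have "open S"
    unfolding S_def using f_cont by (intro open_Collect_less) auto
  have "y + r *\<^sub>R g \<in> S"
  proof (rule ccontr)
    assume "y + r *\<^sub>R g \<notin> S"
    then have "closed_segment y (y + r *\<^sub>R g) - S \<noteq> {}" by auto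
    moreover have "closed_segment y (y + r *\<^sub>R g) \<inter> S \<noteq> {}"
      using less by (force simp: S_def)
    ultimately obtain z where z: "z \<in> closed_segment y (y + r *\<^sub>R g)" "z \<in> frontier S"
      using connected_Int_frontier[OF connected_segment(1)] by blast
    then obtain t where t: "0 \<le> t" "t \<le> 1" and "z = (1 - t) *\<^sub>R y + t *\<^sub>R (y + r *\<^sub>R g)"
      by (auto simp: in_segment)
    then have "z - y = (t * r) *\<^sub>R g" by (simp add: algebra_simps)
    then have "norm (z - y) \<le> r"
      using t g(2) nonneg(3) by (simp add: mult_left_le_one_le)
    then have "L * norm (z - y) powr \<beta> \<le> L * r powr \<beta>"
      using nonneg by (intro mult_left_mono powr_mono2) auto
    moreover have "z \<in> closure S" "z \<notin> S"
      using z(2) \<open>open S\<close> by (auto simp: frontier_def interior_open)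
    ultimately show False
      using hoelder[of z] r by (auto simp: S_def)
  qed
  then have "g \<bullet> (y + r *\<^sub>R g - x) \<le> 0"
    using g(1) by (simp add: S_def star_subdifferential_def)
  moreover have "g \<bullet> g = 1"
    using g(2) by (simp add: norm_eq_1)
  ultimately show ?thesis by (simp add: inner_add_right inner_diff_right)
qed

lemma convex_combination_norm_square_le:
  fixes a b :: "'a::real_inner"
  assumes "0 \<le> \<alpha>" "\<alpha> \<le> 1"
  shows "(norm (\<alpha> *\<^sub>R a + (1 - \<alpha>) *\<^sub>R b))\<^sup>2 \<le> \<alpha> * (norm a)\<^sup>2 + (1 - \<alpha>) * (norm b)\<^sup>2"
proof -
  have "\<alpha> * (norm a)\<^sup>2 + (1 - \<alpha>) * (norm b)\<^sup>2 - (norm (\<alpha> *\<^sub>R a + (1 - \<alpha>) *\<^sub>R b))\<^sup>2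
    = \<alpha> * (1 - \<alpha>) * (norm (a - b))\<^sup>2"
    by (simp add: power2_norm_eq_inner inner_simps inner_commute algebra_simps)
  moreover have "\<dots> \<ge> 0" using assms by simp
  ultimately show ?thesis by linarith
qed

lemma subgradient_step_norm_square_le:
  fixes T :: "'a::{real_inner, complete_space} \<Rightarrow> 'a"
  assumes T: "firmly_nonexpansive T" and y: "T y = y" "y \<in> D"
    and D: "closed D" "convex D"
    and g: "norm g = 1" and \<alpha>: "0 \<le> \<alpha>" "\<alpha> \<le> 1"
    and u: "u = x - v *\<^sub>R g"
  shows "(norm (metric_projection D (\<alpha> *\<^sub>R x + (1 - \<alpha>) *\<^sub>R T u) - y))\<^sup>2
    \<le> (norm (x - y))\<^sup>2 - (1 - \<alpha>) * (2 * v * (g \<bullet> (x - y)) - v\<^sup>2 + (norm (u - T u))\<^sup>2)"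
proof -
  have split: "\<alpha> *\<^sub>R x + (1 - \<alpha>) *\<^sub>R T u - y = \<alpha> *\<^sub>R (x - y) + (1 - \<alpha>) *\<^sub>R (T u - y)"
    by (simp add: algebra_simps)
  have "(norm (metric_projection D (\<alpha> *\<^sub>R x + (1 - \<alpha>) *\<^sub>R T u) - y))\<^sup>2
      \<le> (norm (\<alpha> *\<^sub>R x + (1 - \<alpha>) *\<^sub>R T u - y))\<^sup>2"
    by (intro power_mono metric_projection_Fejer D y) auto
  also have "\<dots> \<le> \<alpha> * (norm (x - y))\<^sup>2 + (1 - \<alpha>) * (norm (T u - y))\<^sup>2"
    unfolding split by (rule convex_combination_norm_square_le[OF \<alpha>])
  also have "\<dots> \<le> \<alpha> * (norm (x - y))\<^sup>2 + (1 - \<alpha>) *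
      ((norm (x - y))\<^sup>2 - (2 * v * (g \<bullet> (x - y)) - v\<^sup>2 + (norm (u - T u))\<^sup>2))"
  proof -
    have "(norm (T u - T y))\<^sup>2 + (norm ((u - T u) - (y - T y)))\<^sup>2 \<le> (norm (u - y))\<^sup>2"
      using T by (auto simp: firmly_nonexpansive_def)
    then have "(norm (T u - y))\<^sup>2 + (norm (u - T u))\<^sup>2 \<le> (norm (u - y))\<^sup>2" using y(1) by simp
    moreover have "(norm (u - y))\<^sup>2 = (norm (x - y))\<^sup>2 - 2 * v * (g \<bullet> (x - y)) + v\<^sup>2"
    proof -
      have "g \<bullet> g = 1" using g by (simp add: norm_eq_1)
      then show ?thesis
        unfolding u power2_norm_eq_inner
        by (simp add: inner_simps inner_commute power2_eq_square algebra_simps)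
    qed
    ultimately have "(norm (T u - y))\<^sup>2
        \<le> (norm (x - y))\<^sup>2 - (2 * v * (g \<bullet> (x - y)) - v\<^sup>2 + (norm (u - T u))\<^sup>2)" by linarith
    then show ?thesis using \<alpha> by (intro add_left_mono mult_left_mono) auto
  qed
  finally show ?thesis by (simp add: algebra_simps)
qed

section \<open>Real sequences that decrease by steps with a divergent sum\<close>

lemma not_eventually_decreasing_by_divergent_steps:
  fixes \<Gamma> v :: "nat \<Rightarrow> real"
  assumes nonneg: "\<And>k. 0 \<le> \<Gamma> k" and "c > 0"
    and v_sum: "filterlim (\<lambda>n. \<Sum>k=1..n. v k) at_top sequentially"
  shows "\<not> (\<forall>\<^sub>F k in sequentially. \<Gamma> (Suc k) \<le> \<Gamma> k - c * v k)"
proof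
  assume "\<forall>\<^sub>F k in sequentially. \<Gamma> (Suc k) \<le> \<Gamma> k - c * v k"
  then obtain n where dec: "\<And>k. k \<ge> n \<Longrightarrow> \<Gamma> (Suc k) \<le> \<Gamma> k - c * v k"
    by (auto simp: eventually_sequentially)
  define K where "K = c * (\<Sum>k=1..n. v k) + \<Gamma> (Suc n)"
  have "c * (\<Sum>k=1..m. v k) + \<Gamma> (Suc m) \<le> K" if "m \<ge> n" for m
    using that
  proof (induction m rule: dec_induct)
    case base
    show ?case by (simp add: K_def)
  next
    case (step m)
    then show ?case using dec[of "Suc m"] by (simp add: distrib_left)
  qed
  then have bound: "c * (\<Sum>k=1..m. v k) \<le> K" if "m \<ge> n" for m
    using that nonneg[of "Suc m"] by force
  have "\<forall>\<^sub>F m in sequentially. (\<Sum>k=1..m. v k) \<ge> K / c + 1"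
    using v_sum by (simp add: filterlim_at_top)
  then have "\<forall>\<^sub>F m in sequentially. m \<ge> n \<and> (\<Sum>k=1..m. v k) \<ge> K / c + 1"
    using eventually_ge_at_top eventually_conj by blast
  then obtain m where "m \<ge> n" "(\<Sum>k=1..m. v k) \<ge> K / c + 1"
    by (metis (mono_tags, lifting) eventually_happens' trivial_limit_sequentially)
  then have "c * (\<Sum>k=1..m. v k) \<ge> K + c" "c * (\<Sum>k=1..m. v k) \<le> K"
    using \<open>c > 0\<close> bound by (auto simp: field_simps)
  then show False using \<open>c > 0\<close> by simp
qed

text \<open>
  Above the level \<open>e / 2\<close> the sequence decreases, and cannot do so for ever; from below \<open>e / 2\<close> one
  step leads to less than \<open>e\<close> once \<open>d k < e / 2\<close>. So the interval below \<open>e\<close> is entered and never left.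
\<close>

lemma tendsto_zero_if_decreasing_away_from_zero:
  fixes \<Gamma> v d :: "nat \<Rightarrow> real"
  assumes nonneg: "\<And>k. 0 \<le> \<Gamma> k" and v_nonneg: "\<And>k. k \<ge> 1 \<Longrightarrow> 0 \<le> v k"
    and v_sum: "filterlim (\<lambda>n. \<Sum>k=1..n. v k) at_top sequentially"
    and decrease: "\<And>\<eta>. \<eta> > 0 \<Longrightarrow>
      \<exists>c>0. \<forall>\<^sub>F k in sequentially. \<eta> \<le> \<Gamma> k \<longrightarrow> \<Gamma> (Suc k) \<le> \<Gamma> k - c * v k"
    and increase: "\<forall>\<^sub>F k in sequentially. \<Gamma> (Suc k) \<le> \<Gamma> k + d k"
    and d: "d \<longlonglongrightarrow> 0"
  shows "\<Gamma> \<longlonglongrightarrow> 0"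
proof (rule order_tendstoI)
  fix e :: real assume "e < 0"
  then show "\<forall>\<^sub>F k in sequentially. e < \<Gamma> k"
    using nonneg by (auto intro!: always_eventually intro: less_le_trans)
next
  fix e :: real assume "0 < e"
  then obtain c where "c > 0"
    and dec: "\<forall>\<^sub>F k in sequentially. e / 2 \<le> \<Gamma> k \<longrightarrow> \<Gamma> (Suc k) \<le> \<Gamma> k - c * v k"
    using decrease[of "e / 2"] by auto
  have "\<forall>\<^sub>F k in sequentially. d k < e / 2"
    using \<open>0 < e\<close> by (intro order_tendstoD[OF d]) simp
  with dec increase have "\<forall>\<^sub>F k in sequentially. k \<ge> 1 \<and> d k < e / 2 \<and> \<Gamma> (Suc k) \<le> \<Gamma> k + d k \<and>
      (e / 2 \<le> \<Gamma> k \<longrightarrow> \<Gamma> (Suc k) \<le> \<Gamma> k - c * v k)"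
    using eventually_ge_at_top[of 1] by eventually_elim blast
  then obtain n where n: "\<And>k. k \<ge> n \<Longrightarrow> k \<ge> 1 \<and> d k < e / 2 \<and> \<Gamma> (Suc k) \<le> \<Gamma> k + d k \<and>
      (e / 2 \<le> \<Gamma> k \<longrightarrow> \<Gamma> (Suc k) \<le> \<Gamma> k - c * v k)"
    by (auto simp: eventually_sequentially)
  obtain m where "m \<ge> n" "\<Gamma> m < e / 2"
  proof (rule ccontr)
    assume "\<not> thesis"
    then have "\<forall>k\<ge>n. e / 2 \<le> \<Gamma> k" using that not_le by blast
    then have "\<forall>\<^sub>F k in sequentially. \<Gamma> (Suc k) \<le> \<Gamma> k - c * v k"
      using n by (auto simp: eventually_sequentially)
    then show False
      using not_eventually_decreasing_by_divergent_steps[where \<Gamma> = \<Gamma>, OF nonneg \<open>c > 0\<close> v_sum] by blast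
  qed
  have "\<Gamma> k < e" if "k \<ge> m" for k
    using that
  proof (induction k rule: dec_induct)
    case base
    show ?case using \<open>\<Gamma> m < e / 2\<close> \<open>0 < e\<close> by simp
  next
    case (step k)
    then have k: "k \<ge> n" using \<open>m \<ge> n\<close> by simp
    show ?case
    proof (cases "e / 2 \<le> \<Gamma> k")
      case True
      moreover have "0 \<le> c * v k" using n[OF k] v_nonneg \<open>c > 0\<close> by simp
      ultimately show ?thesis using n[OF k] step.IH by linarith
    next
      case False
      then show ?thesis using n[OF k] by linarith
    qed
  qed
  then show "\<forall>\<^sub>F k in sequentially. \<Gamma> k < e"
    by (auto simp: eventually_sequentially)
qed

section \<open>The subgradient method with a fixed point constraint\<close>

lemma quasiconvex_sublevel_convex:
  assumes "quasiconvex f"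
  shows "convex {y. f y \<le> c}"
proof (rule convexI)
  fix y z and a b :: real
  assume *: "y \<in> {y. f y \<le> c}" "z \<in> {y. f y \<le> c}" "0 \<le> a" "0 \<le> b" "a + b = 1"
  then have "f ((1 - b) *\<^sub>R y + b *\<^sub>R z) \<le> max (f y) (f z)"
    using assms by (auto simp: quasiconvex_def)
  moreover have "1 - b = a" using * by simp
  ultimately show "a *\<^sub>R y + b *\<^sub>R z \<in> {y. f y \<le> c}" using * by auto
qed

text \<open>
  The iteration together with one chosen minimiser \<open>xs\<close>, to which all distances refer. The number
  \<open>a\<close> lies between the upper limit of \<open>\<alpha>\<close> and \<open>1\<close>, so that the factor \<open>1 - \<alpha> k\<close> of the
  decrease is eventually at least \<open>1 - a > 0\<close>.
\<close>

locale fixed_point_subgradient_method =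
  fixes f :: "'a::{real_inner, complete_space} \<Rightarrow> real"
    and T :: "'a \<Rightarrow> 'a" and D :: "'a set"
    and v \<alpha> :: "nat \<Rightarrow> real" and x g :: "nat \<Rightarrow> 'a"
    and \<beta> L a :: real and xs :: 'a
  assumes f_cont: "continuous_on UNIV f"
    and f_qc: "quasiconvex f"
    and T: "firmly_nonexpansive T"
    and D: "closed D" "convex D"
    and v_pos: "\<And>k. k \<ge> 1 \<Longrightarrow> v k > 0"
    and \<alpha>_range: "\<And>k. k \<ge> 1 \<Longrightarrow> 0 < \<alpha> k \<and> \<alpha> k \<le> 1"
    and \<alpha>_less: "a < 1" "\<forall>\<^sub>F k in sequentially. \<alpha> k \<le> a"
    and x_init: "x 1 \<in> D"
    and g: "\<And>k. k \<ge> 1 \<Longrightarrow> g k \<in> star_subdifferential f (x k) \<and> norm (g k) = 1"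
    and x_step: "\<And>k. k \<ge> 1 \<Longrightarrow>
      x (Suc k) =
        metric_projection D (\<alpha> k *\<^sub>R x k + (1 - \<alpha> k) *\<^sub>R T (x k - v k *\<^sub>R g k))"
    and \<beta>_pos: "\<beta> > 0"
    and L_pos: "L > 0"
    and x_bdd: "bounded (x ` {1..})"
    and v_lim: "v \<longlonglongrightarrow> 0"
    and v_sum: "filterlim (\<lambda>n. \<Sum>k=1..n. v k) at_top sequentially"
    and xs: "xs \<in> argmin_set f (Fix T \<inter> D)"
    and hoelder: "\<And>k z. k \<ge> 1 \<Longrightarrow> f xs < f (x k) \<Longrightarrow> z \<in> closure {y. f y < f (x k)}
      \<Longrightarrow> \<bar>f z - f xs\<bar> \<le> L * norm (z - xs) powr \<beta>"
begin

abbreviation u :: "nat \<Rightarrow> 'a" where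
  "u k \<equiv> x k - v k *\<^sub>R g k"

definition near_optimal :: "real \<Rightarrow> nat \<Rightarrow> bool" where
  "near_optimal e k \<longleftrightarrow> norm (u k - T (u k)) < e \<and> f (x k) < f xs + e"

lemma near_optimal_mono: "near_optimal d k \<Longrightarrow> d \<le> e \<Longrightarrow> near_optimal e k"
  by (simp add: near_optimal_def)

text \<open>
  Some bound for the distances from \<open>xs\<close>; it exists because the sequence is bounded.
\<close>

definition R :: real where
  "R = (SOME M. \<forall>k\<ge>1. norm (x k - xs) \<le> M)"

lemma dist_le_R: "k \<ge> 1 \<Longrightarrow> norm (x k - xs) \<le> R"
proof -
  obtain B where "\<And>k. k \<ge> 1 \<Longrightarrow> norm (x k) \<le> B"
    using x_bdd by (auto simp: bounded_iff)
  then have "\<forall>k\<ge>1. norm (x k - xs) \<le> B + norm xs"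
    using norm_triangle_ineq4 add_right_mono order_trans by blast
  then have "\<forall>k\<ge>1. norm (x k - xs) \<le> R"
    unfolding R_def by (rule someI)
  then show "k \<ge> 1 \<Longrightarrow> norm (x k - xs) \<le> R" by blast
qed

lemma xs_mem: "T xs = xs" "xs \<in> D"
  and xs_minimal: "T y = y \<Longrightarrow> y \<in> D \<Longrightarrow> f xs \<le> f y"
  using xs by (auto simp: argmin_set_def Fix_def is_arg_min_linorder)

lemma x_mem: "k \<ge> 1 \<Longrightarrow> x k \<in> D"
proof (induction k rule: dec_induct)
  case (step k)
  then show ?case using xs_mem(2) by (auto simp: x_step intro: metric_projection_mem[OF D])
qed (use x_init in simp)

lemma step_norm_square_le:
  assumes "k \<ge> 1"
  shows "(norm (x (Suc k) - xs))\<^sup>2 \<le> (norm (x k - xs))\<^sup>2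
    - (1 - \<alpha> k) * (2 * v k * (g k \<bullet> (x k - xs)) - (v k)\<^sup>2 + (norm (u k - T (u k)))\<^sup>2)"
  unfolding x_step[OF assms]
  using \<alpha>_range[OF assms] g[OF assms]
  by (intro subgradient_step_norm_square_le[OF T xs_mem D]) auto

lemma subgradient_inner_ge:
  assumes "k \<ge> 1"
  shows "g k \<bullet> (x k - xs) \<ge> - R"
  using Cauchy_Schwarz_ineq2[of "g k" "x k - xs"] g[OF assms] dist_le_R[OF assms] by simp

text \<open>
  At indices where \<open>f (x k) \<le> f xs\<close>, the subgradient may point away from \<open>xs\<close>. The loss is bounded
  by the Cauchy-Schwarz inequality and is of the order of \<open>v k\<close>.
\<close>

lemma step_norm_square_increase:
  assumes "k \<ge> 1"
  shows "(norm (x (Suc k) - xs))\<^sup>2 \<le> (norm (x k - xs))\<^sup>2 + (2 * v k * R + (v k)\<^sup>2)"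
proof -
  define b where "b = 2 * v k * (g k \<bullet> (x k - xs)) - (v k)\<^sup>2 + (norm (u k - T (u k)))\<^sup>2"
  have vk: "v k > 0" using v_pos assms by blast
  have "2 * v k * (- R) \<le> 2 * v k * (g k \<bullet> (x k - xs))"
    using vk subgradient_inner_ge[OF assms] by (intro mult_left_mono) auto
  moreover have "0 \<le> (norm (u k - T (u k)))\<^sup>2" by simp
  ultimately have b: "- b \<le> 2 * v k * R + (v k)\<^sup>2"
    unfolding b_def mult_minus_right by linarith
  have "0 \<le> R" using dist_le_R[OF assms] norm_ge_zero order_trans by blast
  have "(1 - \<alpha> k) * (- b) \<le> (1 - \<alpha> k) * (2 * v k * R + (v k)\<^sup>2)"
    using b \<alpha>_range[OF assms] by (intro mult_left_mono) auto
  also have "\<dots> \<le> 1 * (2 * v k * R + (v k)\<^sup>2)"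
    using \<alpha>_range[OF assms] vk \<open>0 \<le> R\<close> by (intro mult_right_mono) auto
  finally show ?thesis
    using step_norm_square_le[OF assms] unfolding b_def[symmetric] mult_minus_right mult_1
    by linarith
qed

text \<open>
  The number \<open>r\<close> solves \<open>L * r powr \<beta> = e / 2\<close>, so it bounds \<open>g k \<bullet> (x k - xs)\<close> from below when the
  excess of \<open>f\<close> is at least \<open>e\<close>, and the gain \<open>2 * v k * r\<close> exceeds \<open>(v k)\<^sup>2\<close> by \<open>v k * r\<close> once
  \<open>v k < r\<close>. When the residual is at least \<open>e\<close>, the gain \<open>e\<^sup>2\<close> is eventually larger than
  the possible losses \<open>2 * v k * R + (v k)\<^sup>2\<close> and \<open>v k * r\<close> together.
\<close>

lemma decrease_if_not_near_optimal:
  assumes "e > 0"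
  shows "\<exists>c>0. \<forall>\<^sub>F k in sequentially. \<not> near_optimal e k \<longrightarrow>
    (norm (x (Suc k) - xs))\<^sup>2 \<le> (norm (x k - xs))\<^sup>2 - c * v k"
proof -
  define r where "r = (e / (2 * L)) powr (1 / \<beta>)"
  have "r > 0" using assms L_pos by (simp add: r_def)
  have "L * r powr \<beta> = e / 2"
    using assms L_pos \<beta>_pos by (simp add: r_def powr_powr)
  then have r: "L * r powr \<beta> < e" using assms by simp
  have "(\<lambda>k. v k * (2 * R + v k + r)) \<longlonglongrightarrow> 0 * (2 * R + 0 + r)"
    by (intro tendsto_intros v_lim)
  then have "\<forall>\<^sub>F k in sequentially. v k * (2 * R + v k + r) < e\<^sup>2"
    using assms by (intro order_tendstoD) auto
  moreover have "\<forall>\<^sub>F k in sequentially. v k < r"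
    by (intro order_tendstoD[OF v_lim] \<open>r > 0\<close>)
  ultimately have "\<forall>\<^sub>F k in sequentially. \<not> near_optimal e k \<longrightarrow>
      (norm (x (Suc k) - xs))\<^sup>2 \<le> (norm (x k - xs))\<^sup>2 - ((1 - a) * r) * v k"
    using eventually_ge_at_top[of 1] \<alpha>_less(2)
  proof eventually_elim
    case (elim k)
    show ?case
    proof
      assume bad: "\<not> near_optimal e k"
      define b where "b = 2 * v k * (g k \<bullet> (x k - xs)) - (v k)\<^sup>2 + (norm (u k - T (u k)))\<^sup>2"
      have vk: "v k > 0" using v_pos elim by blast
      have sq: "0 \<le> (norm (u k - T (u k)))\<^sup>2" by simp
      have "v k * r \<le> b"
      proof (cases "f (x k) < f xs + e")
        case True
        then have "e \<le> norm (u k - T (u k))" using bad by (simp add: near_optimal_def)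
        then have "e\<^sup>2 \<le> (norm (u k - T (u k)))\<^sup>2" using assms by (intro power_mono) auto
        moreover have "2 * v k * (- R) \<le> 2 * v k * (g k \<bullet> (x k - xs))"
          using vk subgradient_inner_ge[of k] elim by (intro mult_left_mono) auto
        moreover have "2 * v k * R + (v k)\<^sup>2 + v k * r < e\<^sup>2"
          using elim by (simp add: algebra_simps power2_eq_square)
        ultimately show ?thesis unfolding b_def mult_minus_right by linarith
      next
        case False
        then have less: "f xs < f (x k)" and gap: "L * r powr \<beta> < f (x k) - f xs"
          using assms r by auto
        have "r \<le> g k \<bullet> (x k - xs)"
          using subgradient_inner_lower_bound[OF f_cont _ _ less _ _ _ _ gap]
            g[of k] elim hoelder[OF _ less] \<open>r > 0\<close> L_pos \<beta>_pos by auto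
        then have "2 * v k * r \<le> 2 * v k * (g k \<bullet> (x k - xs))"
          using vk by (intro mult_left_mono) auto
        moreover have "(v k)\<^sup>2 \<le> v k * r"
          using vk elim by (simp add: power2_eq_square)
        ultimately show ?thesis using sq unfolding b_def by linarith
      qed
      then have "(1 - a) * (v k * r) \<le> (1 - \<alpha> k) * b"
        using elim \<alpha>_range[of k] vk \<open>r > 0\<close> by (intro mult_mono) auto
      then show "(norm (x (Suc k) - xs))\<^sup>2 \<le> (norm (x k - xs))\<^sup>2 - ((1 - a) * r) * v k"
        using step_norm_square_le[OF elim(3)] by (simp add: b_def mult_ac)
    qed
  qed
  moreover have "(1 - a) * r > 0" using \<alpha>_less(1) \<open>r > 0\<close> by simp
  ultimately show ?thesis by blast
qed

lemma frequently_near_optimal: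
  assumes "e > 0"
  shows "\<exists>k\<ge>m. near_optimal e k"
proof (rule ccontr)
  assume "\<not> ?thesis"
  then have never: "\<forall>\<^sub>F k in sequentially. \<not> near_optimal e k"
    by (auto simp: eventually_sequentially)
  obtain c where "c > 0" and c: "\<forall>\<^sub>F k in sequentially. \<not> near_optimal e k \<longrightarrow>
      (norm (x (Suc k) - xs))\<^sup>2 \<le> (norm (x k - xs))\<^sup>2 - c * v k"
    using decrease_if_not_near_optimal[OF assms] by blast
  from never c have "\<forall>\<^sub>F k in sequentially.
      (norm (x (Suc k) - xs))\<^sup>2 \<le> (norm (x k - xs))\<^sup>2 - c * v k"
    by eventually_elim blast
  then show False
    using not_eventually_decreasing_by_divergent_steps[where \<Gamma> = "\<lambda>k. (norm (x k - xs))\<^sup>2",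
        OF _ \<open>c > 0\<close> v_sum] by simp
qed

text \<open>
  Since \<open>v k\<close> tends to \<open>0\<close>, the points \<open>u (r n)\<close> have the same weak limit as \<open>x (r n)\<close>, and
  their residuals tend to \<open>0\<close>.
\<close>

lemma near_optimal_weak_cluster_point:
  assumes weak: "weakly_converges (x \<circ> r) p" and r: "\<And>n. r n \<ge> 1" "filterlim r at_top sequentially"
    and near: "\<And>e. e > 0 \<Longrightarrow> \<forall>\<^sub>F n in sequentially. near_optimal e (r n)"
  shows "p \<in> argmin_set f (Fix T \<inter> D)"
proof -
  have "norm (- (v (r n) *\<^sub>R g (r n))) = v (r n)" for n
    using g[OF r(1)] v_pos[OF r(1)] by (simp add: less_imp_le)
  with filterlim_compose[OF v_lim r(2)]
  have "(\<lambda>n. norm (- (v (r n) *\<^sub>R g (r n)))) \<longlonglongrightarrow> 0" by (simp only:)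
  then have v0: "(\<lambda>n. - (v (r n) *\<^sub>R g (r n))) \<longlonglongrightarrow> 0"
    by (rule tendsto_norm_zero_cancel)
  from weakly_converges_add_null[OF weak v0]
  have weak_u: "weakly_converges (\<lambda>n. u (r n)) p" by simp
  have "bounded (range (\<lambda>n. u (r n)))"
  proof -
    have "bounded (range (\<lambda>n. x (r n)))"
      by (rule bounded_subset[OF x_bdd]) (use r in auto)
    then show ?thesis
      using bounded_plus_comp[OF _ convergent_imp_bounded[OF v0], of "\<lambda>n. x (r n)"] by simp
  qed
  moreover have "(\<lambda>n. u (r n) - T (u (r n))) \<longlonglongrightarrow> 0"
  proof (rule tendstoI)
    fix e :: real assume "e > 0"
    from near[OF this] show "\<forall>\<^sub>F n in sequentially. dist (u (r n) - T (u (r n))) 0 < e"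
      by (rule eventually_mono) (simp add: near_optimal_def)
  qed
  ultimately have "T p = p"
    by (rule firmly_nonexpansive_demiclosed[OF T weak_u])
  have "p \<in> D"
    by (rule weakly_convergent_limit_mem[OF D weak]) (use x_mem r in auto)
  have "f p \<le> f xs"
  proof (rule field_le_epsilon)
    fix e :: real assume "e > 0"
    have "p \<in> {y. f y \<le> f xs + e}"
    proof (rule weakly_convergent_limit_mem[OF _ _ weak])
      show "closed {y. f y \<le> f xs + e}"
        using f_cont by (intro closed_Collect_le) auto
      show "convex {y. f y \<le> f xs + e}"
        by (rule quasiconvex_sublevel_convex[OF f_qc])
      show "\<forall>\<^sub>F n in sequentially. (x \<circ> r) n \<in> {y. f y \<le> f xs + e}"
        using near[OF \<open>e > 0\<close>] by (rule eventually_mono) (simp add: near_optimal_def)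
    qed
    then show "f p \<le> f xs + e" by simp
  qed
  with \<open>T p = p\<close> \<open>p \<in> D\<close> xs_minimal show ?thesis
    by (auto simp: argmin_set_def Fix_def is_arg_min_linorder intro: order_trans)
qed

text \<open>
  The side condition \<open>Q\<close> on the indices is trivial for the existence of a weak cluster point. In finite
  dimension it keeps the subsequence away from \<open>xs\<close> and so leads to a contradiction.
\<close>

lemma near_optimal_subseq_weak_limit:
  assumes freq: "\<And>e m. e > 0 \<Longrightarrow> \<exists>k\<ge>m. near_optimal e k \<and> Q k"
  shows "\<exists>r p. strict_mono (r :: nat \<Rightarrow> nat) \<and> (\<forall>n. r n \<ge> 1 \<and> Q (r n)) \<and>
    p \<in> argmin_set f (Fix T \<inter> D) \<and> weakly_converges (x \<circ> r) p"
proof -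
  have "\<exists>k\<ge>m. k \<ge> 1 \<and> near_optimal (1 / real (Suc n)) k \<and> Q k" for n m
    using freq[of "1 / real (Suc n)" "max 1 m"] by auto
  from strict_mono_choice[of "\<lambda>n k. k \<ge> 1 \<and> near_optimal (1 / real (Suc n)) k \<and> Q k", OF this]
  obtain r where r: "strict_mono r"
    and near: "\<And>n. r n \<ge> 1 \<and> near_optimal (1 / real (Suc n)) (r n) \<and> Q (r n)"
    by blast
  have "bounded (range (x \<circ> r))"
    by (rule bounded_subset[OF x_bdd]) (use near in auto)
  then obtain q p where q: "strict_mono q" and weak: "weakly_converges ((x \<circ> r) \<circ> q) p"
    by (rule bounded_imp_weakly_convergent_subseq)
  show ?thesis
  proof (intro exI conjI)
    show mono: "strict_mono (r \<circ> q)" using r q by (rule strict_mono_o)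
    show "\<forall>n. (r \<circ> q) n \<ge> 1 \<and> Q ((r \<circ> q) n)" using near by auto
    show "weakly_converges (x \<circ> (r \<circ> q)) p" using weak by (simp add: o_assoc)
    then show "p \<in> argmin_set f (Fix T \<inter> D)"
    proof (rule near_optimal_weak_cluster_point)
      show "(r \<circ> q) n \<ge> 1" for n using near by auto
      show "filterlim (r \<circ> q) at_top sequentially" using mono by (rule filterlim_subseq)
      fix e :: real assume "e > 0"
      have "(\<lambda>n. 1 / real (Suc n)) \<longlonglongrightarrow> 0" by (rule LIMSEQ_Suc[OF lim_1_over_n])
      then have "\<forall>\<^sub>F n in sequentially. 1 / real (Suc n) < e"
        using \<open>e > 0\<close> by (rule order_tendstoD)
      then have "\<forall>\<^sub>F n in sequentially. near_optimal e (r n)"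
        by (rule eventually_mono) (use near near_optimal_mono less_imp_le in blast)
      then show "\<forall>\<^sub>F n in sequentially. near_optimal e ((r \<circ> q) n)"
        using eventually_subseq[OF q] by simp
    qed
  qed
qed

lemma sequence_converges_if_unique_finite_dim:
  fixes B :: "'a set"
  assumes B: "finite B" "span B = UNIV" and unique: "argmin_set f (Fix T \<inter> D) = {xs}"
  shows "x \<longlonglongrightarrow> xs"
proof -
  have "(\<lambda>k. (norm (x k - xs))\<^sup>2) \<longlonglongrightarrow> 0"
  proof (rule tendsto_zero_if_decreasing_away_from_zero[OF _ _ v_sum])
    show "0 \<le> v k" if "k \<ge> 1" for k using v_pos[OF that] by simp
    show "\<forall>\<^sub>F k in sequentially.
        (norm (x (Suc k) - xs))\<^sup>2 \<le> (norm (x k - xs))\<^sup>2 + (2 * v k * R + (v k)\<^sup>2)"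
      using eventually_ge_at_top[of 1] step_norm_square_increase by (rule eventually_mono)
    have "(\<lambda>k. 2 * v k * R + (v k)\<^sup>2) \<longlonglongrightarrow> 2 * 0 * R + 0\<^sup>2"
      by (intro tendsto_intros v_lim)
    then show "(\<lambda>k. 2 * v k * R + (v k)\<^sup>2) \<longlonglongrightarrow> 0" by simp
  next
    fix \<eta> :: real assume "\<eta> > 0"
    have "\<exists>e>0. \<exists>m. \<forall>k\<ge>m. \<eta> \<le> (norm (x k - xs))\<^sup>2 \<longrightarrow> \<not> near_optimal e k"
    proof (rule ccontr)
      assume "\<not> ?thesis"
      then have "\<exists>k\<ge>m. near_optimal e k \<and> \<eta> \<le> (norm (x k - xs))\<^sup>2" if "e > 0" for e m
        using that by blast
      from near_optimal_subseq_weak_limit[of "\<lambda>k. \<eta> \<le> (norm (x k - xs))\<^sup>2", OF this]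
      obtain r p where r: "\<And>n. \<eta> \<le> (norm (x (r n) - xs))\<^sup>2"
        and p: "p \<in> argmin_set f (Fix T \<inter> D)" "weakly_converges (x \<circ> r) p" by blast
      have "(x \<circ> r) \<longlonglongrightarrow> xs"
        using weakly_convergent_finite_dim[OF B p(2)] p(1) unique by simp
      then have "(\<lambda>n. (norm ((x \<circ> r) n - xs))\<^sup>2) \<longlonglongrightarrow> (norm (xs - xs))\<^sup>2"
        by (intro tendsto_intros)
      then have "\<eta> \<le> (norm (xs - xs))\<^sup>2"
        by (rule LIMSEQ_le_const) (use r in auto)
      then show False using \<open>\<eta> > 0\<close> by simp
    qed
    then obtain e where "e > 0"
      and far: "\<forall>\<^sub>F k in sequentially. \<eta> \<le> (norm (x k - xs))\<^sup>2 \<longrightarrow> \<not> near_optimal e k"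
      by (auto simp: eventually_sequentially)
    obtain c where "c > 0" and dec: "\<forall>\<^sub>F k in sequentially. \<not> near_optimal e k \<longrightarrow>
      (norm (x (Suc k) - xs))\<^sup>2 \<le> (norm (x k - xs))\<^sup>2 - c * v k"
      using decrease_if_not_near_optimal[OF \<open>e > 0\<close>] by blast
    from far dec have "\<forall>\<^sub>F k in sequentially. \<eta> \<le> (norm (x k - xs))\<^sup>2 \<longrightarrow>
      (norm (x (Suc k) - xs))\<^sup>2 \<le> (norm (x k - xs))\<^sup>2 - c * v k"
      by eventually_elim blast
    with \<open>c > 0\<close> show "\<exists>c>0. \<forall>\<^sub>F k in sequentially. \<eta> \<le> (norm (x k - xs))\<^sup>2 \<longrightarrow>
      (norm (x (Suc k) - xs))\<^sup>2 \<le> (norm (x k - xs))\<^sup>2 - c * v k" by blast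
  qed simp
  then have "(\<lambda>k. sqrt ((norm (x k - xs))\<^sup>2)) \<longlonglongrightarrow> sqrt 0"
    by (rule tendsto_real_sqrt)
  then show ?thesis by (simp add: tendsto_norm_zero_iff LIM_zero_iff)
qed

end

section \<open>Convergence to minimisers\<close>

theorem theorem3p2:
  fixes f :: "'a::{real_inner, complete_space} \<Rightarrow> real"
    and X D :: "'a set"
    and T :: "'a \<Rightarrow> 'a"
    and v \<alpha> :: "nat \<Rightarrow> real"
    and x g :: "nat \<Rightarrow> 'a"
    and \<beta> L :: real
    and N :: nat
  assumes f_cont: "continuous_on UNIV f"
    and f_qc: "quasiconvex f"
    and X: "X \<noteq> {}" "closed X" "convex X"
    and D: "D \<noteq> {}" "closed D" "convex D"
    and T: "firmly_nonexpansive T"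
    and FixT: "Fix T = X"
    and XD: "X \<inter> D \<noteq> {}"
    and Xstar: "argmin_set f (X \<inter> D) \<noteq> {}"
    and v_pos: "\<And>k. k \<ge> 1 \<Longrightarrow> v k > 0"
    and \<alpha>_range: "\<And>k. k \<ge> 1 \<Longrightarrow> 0 < \<alpha> k \<and> \<alpha> k \<le> 1"
    and x_init: "x 1 \<in> D"
    and g: "\<And>k. k \<ge> 1 \<Longrightarrow> g k \<in> star_subdifferential f (x k) \<and> norm (g k) = 1"
    and x_step: "\<And>k. k \<ge> 1 \<Longrightarrow>
      x (k + 1) =
        metric_projection D (\<alpha> k *\<^sub>R x k + (1 - \<alpha> k) *\<^sub>R T (x k - v k *\<^sub>R g k))"
    and \<beta>_pos: "\<beta> > 0"
    and L_pos: "L > 0"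
    and hoelder: "\<And>k xs z. \<lbrakk>k \<ge> 1; (INF y\<in>X \<inter> D. f y) < f (x k);
        xs \<in> argmin_set f (X \<inter> D); z \<in> closure {y. f y < f (x k)}\<rbrakk>
      \<Longrightarrow> \<bar>f z - f xs\<bar> \<le> L * norm (z - xs) powr \<beta>"
    and x_bdd: "bounded (x ` {1..})"
    and \<alpha>_liminf: "0 < liminf (\<lambda>k. ereal (\<alpha> k))"
    and \<alpha>_limsup: "limsup (\<lambda>k. ereal (\<alpha> k)) < 1"
    and v_lim: "v \<longlonglongrightarrow> 0"
    and v_sum: "filterlim (\<lambda>n. \<Sum>k=1..n. v k) at_top sequentially"
  shows "(\<exists>r p. strict_mono (r :: nat \<Rightarrow> nat) \<and> (\<forall>n. r n \<ge> 1) \<and> p \<in> argmin_set f (X \<inter> D) \<and>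
            weakly_converges (x \<circ> r) p) \<and>
         (\<forall>xs. (\<exists>B :: 'a set. finite B \<and> card B = N \<and> independent B \<and> span B = UNIV) \<and>
            argmin_set f (X \<inter> D) = {xs} \<longrightarrow> x \<longlonglongrightarrow> xs)"
proof -
  have min: "(INF y\<in>X \<inter> D. f y) = f xs" if "xs \<in> argmin_set f (X \<inter> D)" for xs
    using that by (intro cInf_eq_minimum) (auto simp: argmin_set_def is_arg_min_linorder)
  obtain a where "limsup (\<lambda>k. ereal (\<alpha> k)) < ereal a" "a < 1"
    using ereal_dense2[OF \<alpha>_limsup] by (auto simp: one_ereal_def)
  then have a: "a < 1" "\<forall>\<^sub>F k in sequentially. \<alpha> k \<le> a"
    using Limsup_lessD by (auto elim!: eventually_mono dest: Limsup_lessD)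
  have instance_at: "fixed_point_subgradient_method f T D v \<alpha> x g \<beta> L a xs"
    if "xs \<in> argmin_set f (X \<inter> D)" for xs
  proof
    show "x (Suc k) = metric_projection D (\<alpha> k *\<^sub>R x k + (1 - \<alpha> k) *\<^sub>R T (x k - v k *\<^sub>R g k))"
      if "k \<ge> 1" for k using x_step[OF that] by simp
    show "\<bar>f z - f xs\<bar> \<le> L * norm (z - xs) powr \<beta>"
      if "k \<ge> 1" "f xs < f (x k)" "z \<in> closure {y. f y < f (x k)}" for k z
      using hoelder that min \<open>xs \<in> argmin_set f (X \<inter> D)\<close> by metis
  qed (use assms a that in auto)
  show ?thesis
  proof (intro conjI allI impI)
    obtain xs where "xs \<in> argmin_set f (X \<inter> D)" using Xstar by blast
    then interpret fixed_point_subgradient_method f T D v \<alpha> x g \<beta> L a xs by (rule instance_at)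
    obtain r p where "strict_mono (r :: nat \<Rightarrow> nat)" "\<And>n. r n \<ge> 1"
      "p \<in> argmin_set f (Fix T \<inter> D)" "weakly_converges (x \<circ> r) p"
      using near_optimal_subseq_weak_limit[of "\<lambda>_. True"] frequently_near_optimal by auto
    then show "\<exists>r p. strict_mono (r :: nat \<Rightarrow> nat) \<and> (\<forall>n. r n \<ge> 1) \<and> p \<in> argmin_set f (X \<inter> D) \<and>
        weakly_converges (x \<circ> r) p"
      using FixT by blast
  next
    fix xs
    assume *: "(\<exists>B :: 'a set. finite B \<and> card B = N \<and> independent B \<and> span B = UNIV) \<and>
        argmin_set f (X \<inter> D) = {xs}"
    then interpret fixed_point_subgradient_method f T D v \<alpha> x g \<beta> L a xs
      by (intro instance_at) simp
    show "x \<longlonglongrightarrow> xs"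
      using * sequence_converges_if_unique_finite_dim FixT by blast
  qed
qed

end
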